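(* Let $A$ be a real division algebra of degree $\leq 4$ having a left-unit element (an element $e\in A$ with $ex=x$ for all $x\in A$), and let $q,r\in\{1,2\}$ be fixed. Then the following assertions are equivalent: (1) $A$ satisfies the identity $(x,x^q,x^r)=0$ for all $x\in A$. (2) $A$ is quadratic.
   Context: An algebra over a field is a vector space with a bilinear product, not assumed associative, commutative or unital. The associator is $(x,y,z)=(xy)z-x(yz)$; $x^1=x$ and $x^2=xx$. A real division algebra is a (nonzero) finite-dimensional algebra $A$ over $\mathbb{R}$ such that for every $x\in A\setminus\{0\}$ the left and right multiplication operators $L_x:y\mapsto xy$ and $R_x:y\mapsto yx$ are bijective. For $x\in A$, $A(x)$ denotes the subalgebra of $A$ generated by $x$. The degree of a finite-dimensional algebra $A$ is $\max\{\dim A(y): y\in A\}$. An algebra $A$ is quadratic if it contains a two-sided unit element $e$ and for every $x\in A$ the elements $e,x,x^2$ are linearly dependent. *)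

theory Defs
  imports "HOL-Analysis.Analysis"
begin

text \<open>
  A real algebra is a real vector space, taken to be a whole type of class
  \<^class>\<open>real_vector\<close>, together with a product \<^term>\<open>mul\<close> that is
  \<^const>\<open>bilinear\<close>; the product is not assumed associative, commutative or unital.
\<close>

definition associator :: "('a::real_vector \<Rightarrow> 'a \<Rightarrow> 'a) \<Rightarrow> 'a \<Rightarrow> 'a \<Rightarrow> 'a \<Rightarrow> 'a" where
  "associator mul x y z = mul (mul x y) z - mul x (mul y z)"

text \<open>
  Left-normed powers: the first power of \<open>x\<close> is \<open>x\<close>, the second is \<open>mul x x\<close>, the third
  \<open>mul (mul x x) x\<close>.  There being no unit in general, the exponent \<open>0\<close> has no meaning (the
  value there is \<open>x\<close>).
\<close>

definition alg_power :: "('a::real_vector \<Rightarrow> 'a \<Rightarrow> 'a) \<Rightarrow> 'a \<Rightarrow> nat \<Rightarrow> 'a" where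
  "alg_power mul x n = ((\<lambda>y. mul y x) ^^ (n - 1)) x"

lemma alg_power_simps [simp]:
  "alg_power mul x 1 = x"
  "alg_power mul x (Suc 0) = x"
  "alg_power mul x 2 = mul x x"
  by (simp_all add: alg_power_def)

definition finite_dimensional_algebra :: "('a::real_vector \<Rightarrow> 'a \<Rightarrow> 'a) \<Rightarrow> bool" where
  "finite_dimensional_algebra mul \<longleftrightarrow>
     bilinear mul \<and> (\<exists>B::'a set. finite B \<and> span B = UNIV)"

definition real_division_algebra :: "('a::real_vector \<Rightarrow> 'a \<Rightarrow> 'a) \<Rightarrow> bool" where
  "real_division_algebra mul \<longleftrightarrow>
     finite_dimensional_algebra mul \<and> (\<exists>x::'a. x \<noteq> 0) \<and>
     (\<forall>x. x \<noteq> 0 \<longrightarrow> bij (\<lambda>y. mul x y) \<and> bij (\<lambda>y. mul y x))"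

definition subalgebra :: "('a::real_vector \<Rightarrow> 'a \<Rightarrow> 'a) \<Rightarrow> 'a set \<Rightarrow> bool" where
  "subalgebra mul S \<longleftrightarrow> subspace S \<and> (\<forall>x\<in>S. \<forall>y\<in>S. mul x y \<in> S)"

definition generated_subalgebra :: "('a::real_vector \<Rightarrow> 'a \<Rightarrow> 'a) \<Rightarrow> 'a \<Rightarrow> 'a set" where
  "generated_subalgebra mul x = subalgebra mul hull {x}"

text \<open>
  Meaningful for finite-dimensional algebras only, where the set of dimensions is finite.
\<close>

definition alg_degree :: "('a::real_vector \<Rightarrow> 'a \<Rightarrow> 'a) \<Rightarrow> nat" where
  "alg_degree mul = Max (range (\<lambda>y. dim (generated_subalgebra mul y)))"

definition left_unit :: "('a::real_vector \<Rightarrow> 'a \<Rightarrow> 'a) \<Rightarrow> 'a \<Rightarrow> bool" where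
  "left_unit mul e \<longleftrightarrow> (\<forall>x. mul e x = x)"

definition two_sided_unit :: "('a::real_vector \<Rightarrow> 'a \<Rightarrow> 'a) \<Rightarrow> 'a \<Rightarrow> bool" where
  "two_sided_unit mul e \<longleftrightarrow> (\<forall>x. mul e x = x \<and> mul x e = x)"

text \<open>
  Linear dependence of \<open>e\<close>, \<open>x\<close>, \<open>mul x x\<close> is that of the family: \<^term>\<open>dependent {e, x, mul x x}\<close>
  would be wrong, since it fails when \<open>x = e\<close> and the set collapses to the independent set \<open>{e}\<close>.
\<close>

definition quadratic_algebra :: "('a::real_vector \<Rightarrow> 'a \<Rightarrow> 'a) \<Rightarrow> bool" where
  "quadratic_algebra mul \<longleftrightarrow>
     (\<exists>e. two_sided_unit mul e \<and>
        (\<forall>x. \<exists>a b c :: real. (a, b, c) \<noteq> (0, 0, 0) \<and>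
           a *\<^sub>R e + b *\<^sub>R x + c *\<^sub>R mul x x = 0))"

end

theory Submission
  imports Defs
begin

text \<open>
  Expanding the identity at \<open>e + t y\<close> in powers of \<open>t\<close> shows that \<open>e\<close> is a two-sided unit and
  that \<open>y\<^sup>2 y = y y\<^sup>2\<close> for all \<open>y\<close>. Suppose that \<open>e\<close>, \<open>x\<close>, \<open>x\<^sup>2\<close> are independent. Since a
  real cubic has a root and there are no zero divisors, \<open>e\<close>, \<open>x\<close>, \<open>x\<^sup>2\<close>, \<open>x x\<^sup>2\<close> are
  independent too, so by the bound on the degree they form a basis of \<open>A(x)\<close>. Linearising
  \<open>y\<^sup>2 y = y y\<^sup>2\<close> shows that the basis elements commute. But a commutative real algebra
  without zero divisors has dimension at most 2 (Hopf): otherwise squaring is a two-fold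
  covering of the simply connected punctured space by itself.

  Conversely, in a quadratic algebra the powers of \<open>x\<close> lie in \<open>span {e, x}\<close>, and \<open>(x, x, x) = 0\<close>.
\<close>

section \<open>Squaring in commutative algebras without zero divisors\<close>

lemma bilinear_square_minus:
  assumes "bilinear m" shows "m (- x) (- x) = m x x"
  using assms by (simp add: bilinear_lneg bilinear_rneg)

text \<open>By commutativity \<open>x^2 - y^2\<close> factors as \<open>(x - y)(x + y)\<close>, and
  one factor must vanish. Hence the nonempty fibres of squaring are the pairs
  \<open>{x, - x}\<close>.\<close>

lemma commutative_square_eq_iff:
  assumes bil: "bilinear m" and comm: "\<And>x y. m x y = m y x"
    and nz: "\<And>x y. m x y = 0 \<Longrightarrow> x = 0 \<or> y = 0"
  shows "m x x = m y y \<longleftrightarrow> x = y \<or> x = - y"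
proof
  assume eq: "m x x = m y y"
  have "m (x - y) (x + y) = m x x - m y y + (m x y - m y x)"
    using bil by (simp add: bilinear_lsub bilinear_radd)
  then have "m (x - y) (x + y) = 0"
    using eq comm[of x y] by simp
  then show "x = y \<or> x = - y"
    using nz[of "x - y" "x + y"] by (auto simp: eq_neg_iff_add_eq_0)
qed (auto simp: bilinear_square_minus[OF bil])

lemma bilinear_scale_scale:
  assumes "bilinear m" shows "m (a *\<^sub>R x) (b *\<^sub>R y) = (a * b) *\<^sub>R m x y"
  using assms by (simp add: bilinear_lmul bilinear_rmul)

text \<open>On the compact unit sphere the norm of a square attains a minimum \<open>c\<close>,
  positive because there are no zero divisors; scaling gives
  \<open>norm (m x x) \<ge> c * norm x ^ 2\<close>. So the roots of a convergent sequence of squares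
  are bounded, and a limit of a subsequence of them is a root of the limit.\<close>

lemma closed_range_bilinear_square:
  fixes m :: "'b::euclidean_space \<Rightarrow> 'b \<Rightarrow> 'b"
  assumes bil: "bilinear m" and nz: "\<And>x y. m x y = 0 \<Longrightarrow> x = 0 \<or> y = 0"
  shows "closed (range (\<lambda>x. m x x))"
proof -
  have bb: "bounded_bilinear m"
    using bil bilinear_conv_bounded_bilinear by blast
  have cont: "continuous_on S (\<lambda>x. m x x)" for S
    by (intro bounded_bilinear.continuous_on[OF bb] continuous_intros)
  have "\<exists>u\<in>sphere 0 1. \<forall>v\<in>sphere 0 1. norm (m u u) \<le> norm (m v v)"
    by (rule continuous_attains_inf) (auto intro!: continuous_on_norm cont)
  then obtain u where u: "norm u = 1" "\<And>v. norm v = 1 \<Longrightarrow> norm (m u u) \<le> norm (m v v)"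
    by auto
  define c where "c = norm (m u u)"
  have "c > 0"
    unfolding c_def using nz[of u u] u(1) by auto
  have lower: "c * (norm x)\<^sup>2 \<le> norm (m x x)" for x
  proof (cases "x = 0")
    case False
    have "norm (m x x) = norm (m (norm x *\<^sub>R sgn x) (norm x *\<^sub>R sgn x))"
      using False by (simp add: sgn_div_norm)
    also have "\<dots> = (norm x)\<^sup>2 * norm (m (sgn x) (sgn x))"
      unfolding bilinear_scale_scale[OF bil] by (simp add: power2_eq_square)
    also have "\<dots> \<ge> (norm x)\<^sup>2 * c"
      unfolding c_def using u(2)[of "sgn x"] False by (intro mult_left_mono) (auto simp: norm_sgn)
    finally show ?thesis by (simp add: mult.commute)
  qed simp
  show ?thesis
    unfolding closed_sequential_limits
  proof (intro allI impI)
    fix s y assume "(\<forall>n. s n \<in> range (\<lambda>x. m x x)) \<and> s \<longlonglongrightarrow> y"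
    then have s: "\<forall>n. \<exists>x. s n = m x x" and lim: "s \<longlonglongrightarrow> y" by auto
    from s obtain x where x: "\<And>n. s n = m (x n) (x n)" by metis
    obtain K where K: "\<And>n. norm (s n) \<le> K"
      using convergent_imp_Bseq[OF convergentI[OF lim]] unfolding Bseq_def by auto
    have "norm (x n) \<le> sqrt (K / c)" for n
      using lower[of "x n"] K[of n] x[of n] \<open>c > 0\<close>
      by (intro real_le_rsqrt) (simp add: field_simps)
    then have "bounded (range x)"
      by (auto simp: bounded_iff)
    then obtain l k where k: "strict_mono (k::nat\<Rightarrow>nat)" "(x \<circ> k) \<longlonglongrightarrow> l"
      using bounded_imp_convergent_subsequence by blast
    have "(\<lambda>n. m ((x \<circ> k) n) ((x \<circ> k) n)) \<longlonglongrightarrow> m l l"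
      by (intro bounded_bilinear.tendsto[OF bb] k)
    moreover have "(\<lambda>n. m ((x \<circ> k) n) ((x \<circ> k) n)) = s \<circ> k"
      by (auto simp: x)
    ultimately have "y = m l l"
      using LIMSEQ_subseq_LIMSEQ[OF lim k(1)] LIMSEQ_unique by metis
    then show "y \<in> range (\<lambda>x. m x x)" by blast
  qed
qed

text \<open>An open half-space never contains both \<open>x\<close> and \<open>- x\<close>, so
  squaring is injective there, and invariance of domain makes it a homeomorphism onto an open set.
  The preimage of that set consists of the half-space and its opposite, which are the two sheets.
  Surjectivity follows from connectedness: the image of the punctured space is nonempty, open and
  relatively closed in it.\<close>

lemma covering_space_commutative_square:
  fixes m :: "'b::euclidean_space \<Rightarrow> 'b \<Rightarrow> 'b"
  assumes bil: "bilinear m" and comm: "\<And>x y. m x y = m y x"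
    and nz: "\<And>x y. m x y = 0 \<Longrightarrow> x = 0 \<or> y = 0"
    and dim: "2 \<le> DIM('b)"
  shows "covering_space (- {0}) (\<lambda>x. m x x) (- {0})"
proof -
  define f where "f = (\<lambda>x. m x x)"
  define H where "H a = {x. a \<bullet> x > 0}" for a :: 'b
  have feq: "f x = f y \<longleftrightarrow> x = y \<or> x = - y" for x y
    unfolding f_def using commutative_square_eq_iff[OF bil comm nz] .
  have f0: "f x = 0 \<longleftrightarrow> x = 0" for x
    using feq[of x 0] by (simp add: f_def bilinear_lzero[OF bil])
  have bb: "bounded_bilinear m"
    using bil bilinear_conv_bounded_bilinear by blast
  have cont: "continuous_on S f" for S
    unfolding f_def by (intro bounded_bilinear.continuous_on[OF bb] continuous_intros)
  have openH: "open (H a)" for a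
    unfolding H_def by (simp add: open_halfspace_gt)
  have inj: "inj_on f (H a)" for a
    by (rule inj_onI) (use feq in \<open>force simp: H_def\<close>)
  have memH: "a \<in> H a" if "a \<noteq> 0" for a
    using that by (simp add: H_def)
  have H0: "H a \<subseteq> - {0}" for a
    by (auto simp: H_def)
  have openfH: "open (f ` H a)" for a
    by (rule invariance_of_domain[OF cont openH inj])
  have "f ` (- {0}) = - {0}"
  proof -
    have "f ` (- {0}) = (\<Union>a\<in>-{0}. f ` H a)"
      using memH H0 by blast
    then have op: "open (f ` (- {0}))"
      using openfH by auto
    have sub: "f ` (- {0}) = (- {0}) \<inter> range f"
      using f0 by auto
    have "closed (range f)"
      unfolding f_def by (rule closed_range_bilinear_square[OF bil nz])
    then have "closedin (top_of_set (- {0})) (f ` (- {0}))"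
      unfolding sub by (simp add: closedin_closed_Int)
    moreover have "openin (top_of_set (- {0})) (f ` (- {0}))"
      using op sub by (metis inf_le1 openin_open_eq open_Compl closed_singleton)
    moreover have "connected (- {0::'b})"
      by (rule connected_punctured_universe[OF dim])
    moreover have "f ` (- {0}) \<noteq> {}"
    proof -
      obtain b :: 'b where "b \<in> Basis" using nonempty_Basis by blast
      then show ?thesis using nonzero_Basis by blast
    qed
    ultimately show ?thesis
      unfolding connected_clopen by metis
  qed
  moreover have "\<exists>T. y \<in> T \<and> openin (top_of_set (- {0})) T \<and>
      (\<exists>v. \<Union>v = (- {0}) \<inter> f -` T \<and> (\<forall>u\<in>v. openin (top_of_set (- {0})) u) \<and>
        pairwise disjnt v \<and> (\<forall>u\<in>v. \<exists>q. homeomorphism u T f q))"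
    if "y \<in> - {0}" for y
  proof -
    from that calculation obtain a where a: "a \<noteq> 0" "y = f a" by blast
    have img: "f ` H (- a) = f ` H a"
    proof -
      have "H (- a) = uminus ` H a"
        by (auto simp: H_def image_iff intro: exI[of _ "- _"]) (metis inner_minus_right minus_minus neg_0_less_iff_less)
      moreover have "f (- x) = f x" for x using feq by blast
      ultimately show ?thesis by (simp add: image_image)
    qed
    show ?thesis
    proof (intro exI[of _ "f ` H a"] exI[of _ "{H a, H (- a)}"] conjI)
      show "y \<in> f ` H a" using a memH by blast
      show "openin (top_of_set (- {0})) (f ` H a)"
      proof -
        have "f ` H a \<subseteq> - {0}"
        proof (intro image_subsetI)
          fix x assume "x \<in> H a"
          then have "x \<noteq> 0" by (auto simp: H_def)
          then show "f x \<in> - {0}" using f0[of x] by simp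
        qed
        then show ?thesis using openfH by (intro open_subset)
      qed
      show "\<Union>{H a, H (- a)} = - {0} \<inter> f -` (f ` H a)"
      proof -
        have "x \<in> H a \<or> x \<in> H (- a)" if "f x = f z" "z \<in> H a" for x z
          using that feq by (auto simp: H_def)
        then show ?thesis using img H0[of a] H0[of "-a"] by blast
      qed
      show "\<forall>u\<in>{H a, H (- a)}. openin (top_of_set (- {0})) u"
        using openH H0 by (auto intro: open_subset)
      show "pairwise disjnt {H a, H (- a)}"
        by (auto simp: pairwise_def disjnt_def H_def)
      show "\<forall>u\<in>{H a, H (- a)}. \<exists>q. homeomorphism u (f ` H a) f q"
        using invariance_of_domain_homeomorphism[OF openH cont order_refl inj] img
        by (metis insertE singletonD)
    qed
  qed
  ultimately show ?thesis
    unfolding covering_space_def f_def[symmetric] by (intro conjI ballI cont)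
qed

text \<open>A lift of the identity through the squaring covering would be a continuous square root
  \<open>g\<close>; by connectedness the sign in \<open>g (x\<^sup>2) = \<plusminus>x\<close> is constant, yet
  it changes with \<open>x\<close>.\<close>

theorem commutative_division_dim_le_2:
  fixes m :: "'b::euclidean_space \<Rightarrow> 'b \<Rightarrow> 'b"
  assumes bil: "bilinear m" and comm: "\<And>x y. m x y = m y x"
    and nz: "\<And>x y. m x y = 0 \<Longrightarrow> x = 0 \<or> y = 0"
  shows "DIM('b) \<le> 2"
proof (rule ccontr)
  assume "\<not> DIM('b) \<le> 2"
  then have dim: "3 \<le> DIM('b)" by simp
  let ?P = "- {0::'b}"
  have feq: "m x x = m y y \<longleftrightarrow> x = y \<or> x = - y" for x y
    by (rule commutative_square_eq_iff[OF bil comm nz])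
  have cov: "covering_space ?P (\<lambda>x. m x x) ?P"
    using covering_space_commutative_square[OF bil comm nz] dim by simp
  have cont: "continuous_on ?P (\<lambda>x. m x x)" and img: "(\<lambda>x. m x x) ` ?P = ?P"
    using cov unfolding covering_space_def by auto
  have "locally path_connected ?P"
    by (rule open_imp_locally_path_connected) auto
  then obtain g where g: "continuous_on ?P g" "g \<in> ?P \<rightarrow> ?P" "\<And>y. y \<in> ?P \<Longrightarrow> m (g y) (g y) = y"
    using covering_space_lift[OF cov simply_connected_punctured_universe[OF dim], where f = "\<lambda>x. x"]
      continuous_on_id by blast
  define h where "h = (\<lambda>x. g (m x x))"
  have conth: "continuous_on ?P h"
    unfolding h_def
    using continuous_on_compose2[OF g(1) cont] img by blast
  have hx: "h x = x \<or> h x = - x" if "x \<in> ?P" for x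
    using g(3)[of "m x x"] img that feq unfolding h_def by blast
  \<comment> \<open>\<open>A\<close> and \<open>B\<close> collect the points where the sign is plus
    and minus. Both are relatively closed, and they are complementary since
    \<open>x \<noteq> - x\<close> for nonzero \<open>x\<close>, so \<open>A\<close> is relatively
    clopen.\<close>
  define A where "A = ?P \<inter> (\<lambda>x. h x - x) -` {0}"
  define B where "B = ?P \<inter> (\<lambda>x. h x + x) -` {0}"
  have cl: "closedin (top_of_set ?P) A" "closedin (top_of_set ?P) B"
    unfolding A_def B_def
    by (intro continuous_closedin_preimage continuous_intros conth closed_singleton)+
  have double: "x + x = 0 \<Longrightarrow> x = 0" for x :: 'b
    by (simp flip: scaleR_2)
  have "x \<in> A \<longleftrightarrow> x \<notin> B" if "x \<in> ?P" for x
    using hx[OF that]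
  proof
    assume "h x = x"
    then show ?thesis using that double[of x] by (auto simp: A_def B_def)
  next
    assume "h x = - x"
    moreover have "x = 0" if "- x = x"
      using that add.right_inverse[of x] double[of x] by simp
    ultimately show ?thesis using that by (auto simp: A_def B_def)
  qed
  then have "A = ?P - B"
    by (auto simp: A_def)
  then have "openin (top_of_set ?P) A"
    using cl(2) by (simp add: openin_diff)
  with cl(1) have AP: "A = {} \<or> A = ?P"
    using connected_punctured_universe[of "0::'b"] dim unfolding connected_clopen by auto
  obtain b :: 'b where "b \<in> Basis"
    using nonempty_Basis by blast
  then have b: "b \<in> ?P" "- b \<in> ?P"
    using nonzero_Basis by auto
  have hb: "h (- b) = h b"
    unfolding h_def bilinear_square_minus[OF bil] ..
  have "b + b = 0"
    using AP
  proof
    assume "A = {}"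
    then have "b \<notin> A" "- b \<notin> A" by auto
    then have "h b = - b" "h (- b) = - (- b)"
      using hx[OF b(1)] hx[OF b(2)] b unfolding A_def by auto
    then show ?thesis using hb by (simp add: eq_neg_iff_add_eq_0)
  next
    assume "A = ?P"
    then have "b \<in> A" "- b \<in> A" using b by auto
    then have "h b = b" "h (- b) = - b" unfolding A_def by (auto simp: eq_neg_iff_add_eq_0)
    then show ?thesis using hb by (simp add: eq_neg_iff_add_eq_0)
  qed
  then show False
    using b double[of b] by simp
qed

section \<open>Polynomial coefficients, real roots and dimension counts\<close>

lemma bilinear_associator:
  assumes "bilinear mul" shows "bilinear (associator mul x)"
  unfolding associator_def bilinear_def
  by (intro conjI allI linearI)
    (simp_all add: bilinear_ladd[OF assms] bilinear_radd[OF assms] bilinear_lmul[OF assms]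
      bilinear_rmul[OF assms] scaleR_diff_right)

text \<open>The hypothesis \<open>top\<close> removes the coefficient of \<open>t^4\<close>, leaving
  a cubic in \<open>t\<close> that vanishes for all nonzero \<open>t\<close>. Adding its values at
  \<open>t\<close> and \<open>- t\<close> cancels the odd coefficients; comparing
  \<open>t = 1\<close> with \<open>t = 2\<close> then kills the coefficient \<open>E\<close> of
  \<open>t^2\<close>.\<close>

lemma bilinear_const_coeff_0:
  fixes g :: "'a::real_vector \<Rightarrow> 'b::real_vector \<Rightarrow> 'c::real_vector"
  assumes bil: "bilinear g"
    and zero: "\<And>t::real. t \<noteq> 0 \<Longrightarrow>
      g (a0 + t *\<^sub>R a1 + t\<^sup>2 *\<^sub>R a2) (b0 + t *\<^sub>R b1 + t\<^sup>2 *\<^sub>R b2) = 0"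
    and top: "g a2 b2 = 0"
  shows "g a0 b0 = 0"
proof -
  define E where "E = g a0 b2 + g a1 b1 + g a2 b0"
  define O1 where "O1 = g a0 b1 + g a1 b0"
  define O3 where "O3 = g a1 b2 + g a2 b1"
  have expand: "g a0 b0 + t *\<^sub>R O1 + t\<^sup>2 *\<^sub>R E + t ^ 3 *\<^sub>R O3 = 0" if "t \<noteq> 0" for t
    using zero[OF that]
    by (simp add: E_def O1_def O3_def bilinear_ladd[OF bil] bilinear_radd[OF bil]
        bilinear_lmul[OF bil] bilinear_rmul[OF bil] top algebra_simps power2_eq_square power3_eq_cube)
  have "2 *\<^sub>R (g a0 b0 + t\<^sup>2 *\<^sub>R E) = 0" if "t \<noteq> 0" for t
  proof -
    have "2 *\<^sub>R (g a0 b0 + t\<^sup>2 *\<^sub>R E) = (g a0 b0 + t *\<^sub>R O1 + t\<^sup>2 *\<^sub>R E + t ^ 3 *\<^sub>R O3)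
        + (g a0 b0 + (-t) *\<^sub>R O1 + (-t)\<^sup>2 *\<^sub>R E + (-t) ^ 3 *\<^sub>R O3)"
      unfolding scaleR_2 by (simp add: algebra_simps)
    also have "\<dots> = 0" using expand[of t] expand[of "-t"] that by simp
    finally show ?thesis .
  qed
  then have even: "g a0 b0 + t\<^sup>2 *\<^sub>R E = 0" if "t \<noteq> 0" for t
    using that by (metis scale_eq_0_iff zero_neq_numeral)
  have "3 *\<^sub>R E = (4 - 1) *\<^sub>R E" by simp
  also have "\<dots> = (g a0 b0 + 2\<^sup>2 *\<^sub>R E) - (g a0 b0 + 1\<^sup>2 *\<^sub>R E)"
    by (simp only: scaleR_diff_left) simp
  also have "\<dots> = 0" using even[of 1] even[of 2] by simp
  finally show ?thesis using even[of 1] by simp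
qed

lemma cubic_has_real_root:
  fixes a b c :: real
  obtains t where "t ^ 3 = a + b * t + c * t\<^sup>2"
proof -
  define p where "p = (\<lambda>t. t ^ 3 - c * t\<^sup>2 - b * t - a)"
  \<comment> \<open>With this choice
    \<open>\<bar>a\<bar> + \<bar>b\<bar> + \<bar>c\<bar> = M - 1\<close>, so the leading term
    dominates at both ends of \<open>{- M..M}\<close>. The sign \<open>s\<close> below lets one
    estimate serve both ends.\<close>
  define M where "M = 1 + \<bar>a\<bar> + \<bar>b\<bar> + \<bar>c\<bar>"
  have M1: "M \<ge> 1"
    unfolding M_def by simp
  then have M: "M \<ge> 1" "M\<^sup>2 \<ge> M" "M\<^sup>2 \<ge> 1"
    by (simp_all add: self_le_power one_le_power)
  have "\<bar>c * M\<^sup>2 + b * s * M + a\<bar> < M ^ 3" if "\<bar>s\<bar> = 1" for s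
  proof -
    have "\<bar>c * M\<^sup>2 + b * s * M + a\<bar> \<le> \<bar>c\<bar> * M\<^sup>2 + \<bar>b\<bar> * M + \<bar>a\<bar> * 1"
      using M that by (intro order_trans[OF abs_triangle_ineq] add_mono) (auto simp: abs_mult)
    also have "\<dots> \<le> \<bar>c\<bar> * M\<^sup>2 + \<bar>b\<bar> * M\<^sup>2 + \<bar>a\<bar> * M\<^sup>2"
      using M by (intro add_mono mult_left_mono) auto
    also have "\<dots> = (M - 1) * M\<^sup>2" by (simp add: M_def algebra_simps)
    also have "\<dots> < M ^ 3" using M by (simp add: algebra_simps power2_eq_square power3_eq_cube)
    finally show ?thesis .
  qed
  from this[of 1] this[of "-1"] have "p (- M) \<le> 0" "0 \<le> p M"
    by (auto simp: p_def abs_less_iff)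
  moreover have "continuous_on {- M..M} p"
    unfolding p_def by (intro continuous_intros)
  ultimately obtain t where "p t = 0"
    using IVT'[of p "-M" 0 M] M(1) by auto
  then show ?thesis
    using that[of t] by (simp add: p_def algebra_simps)
qed

text \<open>A vector of \<open>span T\<close> outside \<open>span C\<close> would extend
  \<open>C\<close> to an independent subset of \<open>span T\<close> with more than
  \<open>card T\<close> elements.\<close>

lemma span_eq_of_card_ge:
  fixes C T :: "'a::real_vector set"
  assumes "finite T" "independent C" "C \<subseteq> span T" "card T \<le> card C"
  shows "span T \<subseteq> span C"
proof
  fix v assume v: "v \<in> span T"
  show "v \<in> span C"
  proof (rule ccontr)
    assume nv: "v \<notin> span C"
    then have "independent (insert v C)"
      using assms(2) by (simp add: independent_insert)
    then have "finite (insert v C)" "card (insert v C) \<le> card T"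
      using independent_span_bound[OF assms(1), of "insert v C"] assms(3) v by auto
    moreover have "v \<notin> C" using nv span_base by blast
    ultimately show False using assms(4) by auto
  qed
qed

section \<open>Generated subalgebras and division algebras\<close>

lemma subalgebra_generated: "subalgebra mul (generated_subalgebra mul x)"
  unfolding generated_subalgebra_def
  by (rule hull_in) (auto simp: subalgebra_def intro: subspace_Inter)

lemma mem_generated_subalgebra: "x \<in> generated_subalgebra mul x"
  unfolding generated_subalgebra_def using hull_subset[of "{x}"] by auto

text \<open>A finite spanning set bounds all these dimensions, so the \<open>Max\<close> in
  \<open>alg_degree\<close> is taken over a finite set.\<close>

lemma dim_generated_subalgebra_le_alg_degree:
  assumes "finite_dimensional_algebra mul"
  shows "dim (generated_subalgebra mul x) \<le> alg_degree mul"
proof -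
  obtain B :: "'a set" where "finite B" "span B = UNIV"
    using assms unfolding finite_dimensional_algebra_def by auto
  then have "range (\<lambda>y. dim (generated_subalgebra mul y)) \<subseteq> {.. card B}"
    by (auto intro!: dim_le_card)
  then show ?thesis
    unfolding alg_degree_def by (intro Max_ge) (auto intro: finite_subset)
qed

lemma real_division_algebra_facts:
  fixes mul :: "'a::real_vector \<Rightarrow> 'a \<Rightarrow> 'a"
  assumes "real_division_algebra mul"
  shows "bilinear mul" and "finite_dimensional_algebra mul"
    and "mul x y = 0 \<Longrightarrow> x = 0 \<or> y = 0"
    and "\<exists>x::'a. x \<noteq> 0"
proof -
  show bil: "bilinear mul" and "finite_dimensional_algebra mul" and "\<exists>x::'a. x \<noteq> 0"
    using assms by (auto simp: real_division_algebra_def finite_dimensional_algebra_def)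
  show "x = 0 \<or> y = 0" if "mul x y = 0"
  proof (cases "x = 0")
    case False
    then have "inj (mul x)"
      using assms bij_is_inj by (auto simp: real_division_algebra_def)
    moreover have "mul x y = mul x 0"
      using that bilinear_rzero[OF bil] by simp
    ultimately show ?thesis by (auto dest: injD)
  qed simp
qed

section \<open>Consequences of the identity near a left unit\<close>

text \<open>For a left unit \<open>e\<close> all \<open>(e, u, v)\<close> vanish, so the identity at \<open>e + t y\<close> says that
  \<open>(y, x\<^sup>q, x\<^sup>r) = 0\<close> for \<open>x = e + t y\<close> and \<open>t \<noteq> 0\<close>,
  hence the lowest coefficient in \<open>t\<close> vanishes. It is \<open>(y, e, e)\<close>, which makes \<open>e\<close> a
  right unit, and once this is known the next one is a multiple of \<open>(y, y, y)\<close>.\<close>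

lemma associator_left_unit_shift:
  assumes bil: "bilinear mul" and e: "left_unit mul e" and "t \<noteq> 0"
    and "associator mul (e + t *\<^sub>R y) u v = 0"
  shows "associator mul y u v = 0"
proof -
  have "associator mul (e + t *\<^sub>R y) u v = t *\<^sub>R associator mul y u v"
    using e by (simp add: associator_def left_unit_def bilinear_ladd[OF bil]
        bilinear_lmul[OF bil] bilinear_radd[OF bil] scaleR_diff_right)
  then show ?thesis using assms(3,4) by simp
qed

lemma two_sided_unit_of_left_unit:
  fixes mul :: "'a::real_vector \<Rightarrow> 'a \<Rightarrow> 'a"
  assumes bil: "bilinear mul" and nz: "\<And>x y. mul x y = 0 \<Longrightarrow> x = 0 \<or> y = 0"
    and e: "left_unit mul e" "e \<noteq> 0"
    and q: "q \<in> {1, 2}" and r: "r \<in> {1, 2}"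
    and id: "\<And>x. associator mul x (alg_power mul x q) (alg_power mul x r) = 0"
  shows "two_sided_unit mul e"
proof -
  have ee: "mul e z = z" for z
    using e by (simp add: left_unit_def)
  have "mul y e = y" for y
  proof -
    \<comment> \<open>\<open>u n\<close> and \<open>s n\<close> are the coefficients of
      \<open>t\<close> and \<open>t^2\<close> in the \<open>n\<close>-th power of
      \<open>e + t y\<close>. Only \<open>e y = y\<close> is available so far, so the square
      contributes \<open>y + y e\<close> to the linear term.\<close>
    define u where "u = (\<lambda>n::nat. if n = 1 then y else y + mul y e)"
    define s where "s = (\<lambda>n::nat. if n = 1 then 0 else mul y y)"
    have pow: "alg_power mul (e + t *\<^sub>R y) n = e + t *\<^sub>R u n + t\<^sup>2 *\<^sub>R s n" if "n \<in> {1, 2}" for n t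
      using that by (auto simp: u_def s_def ee bilinear_ladd[OF bil] bilinear_radd[OF bil]
          bilinear_lmul[OF bil] bilinear_rmul[OF bil] power2_eq_square algebra_simps)
    have "associator mul y e e = 0"
    proof (rule bilinear_const_coeff_0[OF bilinear_associator[OF bil]])
      show "associator mul y (e + t *\<^sub>R u q + t\<^sup>2 *\<^sub>R s q) (e + t *\<^sub>R u r + t\<^sup>2 *\<^sub>R s r) = 0"
        if "t \<noteq> 0" for t
        using associator_left_unit_shift[OF bil e(1) that id[of "e + t *\<^sub>R y", unfolded pow[OF q] pow[OF r]]] .
      \<comment> \<open>For \<open>q = r = 2\<close> this is the identity at \<open>y\<close>
        itself; otherwise one of the arguments is 0.\<close>
      show "associator mul y (s q) (s r) = 0"
        using id[of y] q r bil by (auto simp: s_def associator_def bilinear_rzero bilinear_lzero)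
    qed
    then have "mul (mul y e - y) e = 0"
      by (simp add: associator_def ee bilinear_lsub[OF bil])
    from nz[OF this] show ?thesis using e(2) by simp
  qed
  then show ?thesis by (simp add: two_sided_unit_def ee)
qed

lemma third_power_associative_of_unit:
  fixes mul :: "'a::real_vector \<Rightarrow> 'a \<Rightarrow> 'a"
  assumes bil: "bilinear mul" and e: "two_sided_unit mul e"
    and q: "q \<in> {1, 2}" and r: "r \<in> {1, 2}"
    and id: "\<And>x. associator mul x (alg_power mul x q) (alg_power mul x r) = 0"
  shows "associator mul y y y = 0"
proof -
  have ee: "mul e z = z" "mul z e = z" for z
    using e by (auto simp: two_sided_unit_def)
  then have le: "left_unit mul e"
    by (simp add: left_unit_def)
  let ?g = "associator mul y"
  have bg: "bilinear ?g"
    by (rule bilinear_associator[OF bil])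
  have ge: "?g e v = 0" "?g v e = 0" for v
    by (simp_all add: associator_def ee)
  \<comment> \<open>Since \<open>e\<close> is now also a right unit, the linear coefficient
    \<open>y + y e\<close> of the square becomes \<open>2 y\<close>.\<close>
  define d where "d = (\<lambda>n::nat. if n = 1 then y else 2 *\<^sub>R y)"
  define s where "s = (\<lambda>n::nat. if n = 1 then 0 else mul y y)"
  have pow: "alg_power mul (e + t *\<^sub>R y) n = e + t *\<^sub>R (d n + t *\<^sub>R s n)" if "n \<in> {1, 2}" for n t
    using that by (auto simp: d_def s_def ee bilinear_ladd[OF bil] bilinear_radd[OF bil]
        bilinear_lmul[OF bil] bilinear_rmul[OF bil] scaleR_2 algebra_simps)
  have "?g (d q) (d r) = 0"
  proof (rule bilinear_const_coeff_0[OF bg])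
    fix t :: real assume t: "t \<noteq> 0"
    have "?g (e + t *\<^sub>R (d q + t *\<^sub>R s q)) (e + t *\<^sub>R (d r + t *\<^sub>R s r)) = 0"
      using associator_left_unit_shift[OF bil le t id[of "e + t *\<^sub>R y", unfolded pow[OF q] pow[OF r]]] .
    \<comment> \<open>Associators with \<open>e\<close> as second or third entry vanish, so a factor
      \<open>t\<close> comes out of each argument. What remains has constant term
      \<open>?g (d q) (d r)\<close>; below, the linear polynomials are padded with zero quadratic
      coefficients.\<close>
    then have "(t * t) *\<^sub>R ?g (d q + t *\<^sub>R s q) (d r + t *\<^sub>R s r) = 0"
      by (simp add: bilinear_ladd[OF bg, of e] bilinear_radd[OF bg, of _ e] ge bilinear_scale_scale[OF bg]
          del: scaleR_eq_0_iff mult_eq_0_iff)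
    then show "?g (d q + t *\<^sub>R s q + t\<^sup>2 *\<^sub>R 0) (d r + t *\<^sub>R s r + t\<^sup>2 *\<^sub>R 0) = 0"
      using t by simp
  qed (rule bilinear_rzero[OF bg])
  then show ?thesis
    using q r by (auto simp: d_def bilinear_lmul[OF bg] bilinear_rmul[OF bg])
qed

section \<open>From third-power associativity to quadratic relations\<close>

text \<open>The difference of the two sides is the part of \<open>(x + y, x + y, x + y)\<close> of
  degree 2 in \<open>x\<close> and 1 in \<open>y\<close>. Subtracting the associator at
  \<open>x - y\<close> isolates twice this part, up to multiples of
  \<open>(y, y, y)\<close>.\<close>

lemma third_power_associative_linearized:
  fixes mul :: "'a::real_vector \<Rightarrow> 'a \<Rightarrow> 'a"
  assumes bil: "bilinear mul" and cube: "\<And>y. associator mul y y y = 0"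
  shows "mul (mul x y + mul y x) x + mul (mul x x) y
    = mul x (mul x y + mul y x) + mul y (mul x x)"
proof -
  let ?F = "\<lambda>y. associator mul y y y"
  let ?c = "mul (mul x y + mul y x) x + mul (mul x x) y
    - (mul x (mul x y + mul y x) + mul y (mul x x))"
  have "?F (x + y) - ?F (x - y) = ?c + ?c + ?F y + ?F y"
    by (simp add: associator_def bilinear_ladd[OF bil] bilinear_radd[OF bil]
        bilinear_lsub[OF bil] bilinear_rsub[OF bil] algebra_simps)
  then have "?c + ?c = 0"
    by (simp only: cube diff_0_right add_0_right)
  then have "2 *\<^sub>R ?c = 0"
    by (simp only: scaleR_2)
  then show ?thesis by simp
qed

text \<open>Left multiplication by \<open>x\<close> maps the finite-dimensional space
  \<open>S\<close> injectively, hence onto itself. So \<open>x = x u\<close> for some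
  \<open>u\<close> in \<open>S\<close>, and comparison with \<open>x = x e\<close> gives
  \<open>u = e\<close>.\<close>

lemma unit_mem_subalgebra:
  fixes mul :: "'a::real_vector \<Rightarrow> 'a \<Rightarrow> 'a"
  assumes fin: "finite_dimensional_algebra mul"
    and nz: "\<And>x y. mul x y = 0 \<Longrightarrow> x = 0 \<or> y = 0"
    and e: "two_sided_unit mul e"
    and S: "subalgebra mul S" "x \<in> S" "x \<noteq> 0"
  shows "e \<in> S"
proof -
  have bil: "bilinear mul"
    using fin by (simp add: finite_dimensional_algebra_def)
  obtain B :: "'a set" where B: "finite B" "span B = UNIV"
    using fin unfolding finite_dimensional_algebra_def by auto
  obtain T where T: "T \<subseteq> S" "independent T" "S \<subseteq> span T" "card T = dim S"
    using basis_exists .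
  have "finite T"
    using independent_span_bound[OF B(1) T(2)] B(2) by auto
  have lin: "linear (mul x)"
    using bil by (simp add: bilinear_def)
  have inj: "inj (mul x)"
    using nz S(3) by (auto simp: linear_injective_0[OF lin])
  have "span T \<subseteq> span (mul x ` T)"
  proof (rule span_eq_of_card_ge)
    show "independent (mul x ` T)"
      using linear_independent_injective_image[OF lin T(2)] inj by (simp add: inj_on_subset)
    show "mul x ` T \<subseteq> span T"
      using S(1,2) T(1,3) unfolding subalgebra_def by blast
    show "card T \<le> card (mul x ` T)"
      using inj by (simp add: card_image inj_on_subset)
  qed fact
  also have "\<dots> = mul x ` span T"
    by (rule linear_span_image[OF lin])
  finally obtain u where "u \<in> span T" "x = mul x u"
    using S(2) T(3) by blast
  moreover have "mul x e = x"
    using e by (simp add: two_sided_unit_def)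
  ultimately have "u = e"
    using inj by (metis injD)
  moreover have "span T \<subseteq> S"
    using T(1) S(1) by (simp add: subalgebra_def span_minimal)
  ultimately show ?thesis
    using \<open>u \<in> span T\<close> by blast
qed

text \<open>Otherwise multiplication by \<open>x\<close> would act on \<open>span {e, x, x\<^sup>2}\<close>, where it has a
  real eigenvalue \<open>t\<close>, and \<open>x - t e\<close> would be a zero divisor.\<close>

lemma independent_unit_powers:
  fixes mul :: "'a::real_vector \<Rightarrow> 'a \<Rightarrow> 'a"
  assumes bil: "bilinear mul" and nz: "\<And>x y. mul x y = 0 \<Longrightarrow> x = 0 \<or> y = 0"
    and e: "two_sided_unit mul e"
    and ind: "\<And>a b c. a *\<^sub>R e + b *\<^sub>R x + c *\<^sub>R mul x x = 0 \<Longrightarrow> a = 0 \<and> b = 0 \<and> c = 0"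
    and zero: "a *\<^sub>R e + b *\<^sub>R x + c *\<^sub>R mul x x + d *\<^sub>R mul x (mul x x) = 0"
  shows "a = 0 \<and> b = 0 \<and> c = 0 \<and> d = 0"
proof (cases "d = 0")
  case True
  then show ?thesis using ind[of a b c] zero by simp
next
  case False
  define w where "w = mul x x"
  have ee: "mul e z = z" "mul z e = z" for z
    using e by (auto simp: two_sided_unit_def)
  obtain t where t: "t ^ 3 = - a / d + (- b / d) * t + (- c / d) * t\<^sup>2"
    by (rule cubic_has_real_root)
  have "d * t ^ 3 = - a - b * t - c * t\<^sup>2"
    unfolding t using False by (simp add: distrib_left right_diff_distrib)
  then have root: "d * t ^ 3 + c * t\<^sup>2 + b * t + a = 0"
    by simp
  \<comment> \<open>Horner's scheme: dividing \<open>d X^3 + c X^2 + b X + a\<close> by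
    \<open>X - t\<close> gives the quotient \<open>d X^2 + p X + k\<close> and the remainder
    \<open>t k + a\<close>, which is 0 at the root \<open>t\<close>.\<close>
  define p where "p = d * t + c"
  define k where "k = t * p + b"
  have "mul (x - t *\<^sub>R e) (d *\<^sub>R w + p *\<^sub>R x + k *\<^sub>R e)
      = (a *\<^sub>R e + b *\<^sub>R x + c *\<^sub>R w + d *\<^sub>R mul x w) - (t * k + a) *\<^sub>R e"
    by (simp add: p_def k_def ee bilinear_lsub[OF bil] bilinear_radd[OF bil] bilinear_lmul[OF bil]
        bilinear_rmul[OF bil] algebra_simps flip: w_def)
  moreover have "t * k + a = 0"
    using root by (simp add: p_def k_def algebra_simps power2_eq_square power3_eq_cube)
  ultimately have "mul (x - t *\<^sub>R e) (d *\<^sub>R w + p *\<^sub>R x + k *\<^sub>R e) = 0"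
    using zero by (simp add: w_def)
  then consider "x - t *\<^sub>R e = 0" | "d *\<^sub>R w + p *\<^sub>R x + k *\<^sub>R e = 0"
    using nz by blast
  then show ?thesis
  proof cases
    case 1
    then show ?thesis using ind[of "- t" 1 0] by simp
  next
    case 2
    then show ?thesis using ind[of k p d] False by (simp add: w_def algebra_simps)
  qed
qed

lemma quadratic_of_third_power_associative:
  fixes mul :: "'a::real_vector \<Rightarrow> 'a \<Rightarrow> 'a"
  assumes fin: "finite_dimensional_algebra mul"
    and nz: "\<And>x y. mul x y = 0 \<Longrightarrow> x = 0 \<or> y = 0"
    and deg: "alg_degree mul \<le> 4"
    and e: "two_sided_unit mul e"
    and cube: "\<And>y. associator mul y y y = 0"
  shows "\<exists>a b c. (a, b, c) \<noteq> (0, 0, 0) \<and> a *\<^sub>R e + b *\<^sub>R x + c *\<^sub>R mul x x = 0"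
proof (rule ccontr)
  assume "\<not> ?thesis"
  then have ind: "a = 0 \<and> b = 0 \<and> c = 0" if "a *\<^sub>R e + b *\<^sub>R x + c *\<^sub>R mul x x = 0" for a b c
    using that by auto
  have bil: "bilinear mul"
    using fin by (simp add: finite_dimensional_algebra_def)
  note bil_simps = bilinear_ladd[OF bil] bilinear_radd[OF bil] bilinear_lmul[OF bil] bilinear_rmul[OF bil]
  have ee: "mul e z = z" "mul z e = z" for z
    using e by (auto simp: two_sided_unit_def)
  have "x \<noteq> 0"
    using ind[of 0 1 0] by auto
  define w where "w = mul x x"
  define v where "v = mul x w"
  \<comment> \<open>These coordinates identify \<open>real ^ 4\<close> with the subalgebra generated
    by \<open>x\<close>, so that the dimension bound for products on Euclidean spaces can be
    applied.\<close>
  define \<phi> :: "real ^ 4 \<Rightarrow> 'a" where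
    "\<phi> = (\<lambda>u. u $ 1 *\<^sub>R e + u $ 2 *\<^sub>R x + u $ 3 *\<^sub>R w + u $ 4 *\<^sub>R v)"
  have lin: "linear \<phi>"
    by (rule linearI) (simp_all add: \<phi>_def algebra_simps)
  have inj: "inj \<phi>"
    unfolding linear_injective_0[OF lin]
  proof (intro allI impI)
    fix u assume u: "\<phi> u = 0"
    have "u $ 1 = 0 \<and> u $ 2 = 0 \<and> u $ 3 = 0 \<and> u $ 4 = 0"
      by (rule independent_unit_powers[OF bil nz e ind u[unfolded \<phi>_def v_def w_def]])
    then show "u = 0" by (simp add: vec_eq_iff forall_4)
  qed
  let ?S = "generated_subalgebra mul x"
  have S: "subalgebra mul ?S" "x \<in> ?S"
    by (rule subalgebra_generated mem_generated_subalgebra)+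
  have "e \<in> ?S"
    by (rule unit_mem_subalgebra[OF fin nz e S \<open>x \<noteq> 0\<close>])
  then have range_sub: "range \<phi> \<subseteq> ?S"
    using S unfolding \<phi>_def v_def w_def subalgebra_def
    by (auto intro!: subspace_add subspace_scale)
  have "?S \<subseteq> range \<phi>"
  proof -
    obtain B :: "'a set" where B: "finite B" "span B = UNIV"
      using fin unfolding finite_dimensional_algebra_def by auto
    obtain T where T: "T \<subseteq> ?S" "independent T" "?S \<subseteq> span T" "card T = dim ?S"
      using basis_exists .
    have "finite T"
      using independent_span_bound[OF B(1) T(2)] B(2) by auto
    \<comment> \<open>The four images are independent and lie in a space of dimension at most 4, by
      the bound on the degree, so they span it.\<close>
    have "span T \<subseteq> span (\<phi> ` Basis)"
    proof (rule span_eq_of_card_ge)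
      show "independent (\<phi> ` Basis)"
        using linear_independent_injective_image[OF lin independent_Basis] inj by (simp add: inj_on_subset)
      show "\<phi> ` Basis \<subseteq> span T"
        using range_sub T(3) by blast
      show "card T \<le> card (\<phi> ` Basis)"
        using inj T(4) deg dim_generated_subalgebra_le_alg_degree[OF fin, of x]
        by (simp add: card_image inj_on_subset)
    qed fact
    also have "\<dots> = range \<phi>"
      by (simp add: linear_span_image[OF lin])
    finally show ?thesis using T(3) by blast
  qed
  then have range: "range \<phi> = ?S" using range_sub by blast
  have closed: "mul (\<phi> u) (\<phi> u') \<in> range \<phi>" for u u'
    using S(1) unfolding range[symmetric] subalgebra_def by blast
  note linearized = third_power_associative_linearized[OF bil cube, of x]
  have wx: "mul w x = v"
    using cube[of x] by (simp add: associator_def w_def v_def)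
  have double: "a = b" if "a + a = b + b" for a b :: 'a
    using that by (metis scaleR_2 scaleR_cancel_left zero_neq_numeral)
  \<comment> \<open>In the linearised identity at \<open>y = w\<close> the terms \<open>w w\<close>
    cancel, leaving \<open>2 (v x) = 2 (x v)\<close>.\<close>
  have vx: "mul v x = mul x v"
  proof (rule double)
    show "mul v x + mul v x = mul x v + mul x v"
      using linearized[of w] by (simp add: wx bil_simps flip: w_def v_def)
  qed
  have x_comm: "mul x (\<phi> u) = mul (\<phi> u) x" for u
    by (simp add: \<phi>_def bil_simps ee wx vx flip: w_def v_def)
  have "v \<in> range \<phi>"
    by (rule range_eqI[of _ _ "axis 4 1"]) (simp add: \<phi>_def axis_def)
  then have "mul x v \<in> range \<phi>"
    using S unfolding range subalgebra_def by blast
  then have "mul x (mul x v) = mul (mul x v) x"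
    using x_comm by auto
  \<comment> \<open>In the linearised identity at \<open>y = v\<close> the other terms cancel
    because \<open>x\<close> commutes with \<open>x v\<close>, which lies in the range of
    \<open>\<phi>\<close>. All pairs among \<open>e\<close>, \<open>x\<close>, \<open>w\<close>,
    \<open>v\<close> now commute.\<close>
  then have wv: "mul w v = mul v w"
    using linearized[of v] by (simp add: vx bil_simps flip: w_def)
  have comm: "mul (\<phi> u) (\<phi> u') = mul (\<phi> u') (\<phi> u)" for u u'
    by (simp add: \<phi>_def bil_simps ee wx vx wv algebra_simps flip: w_def v_def)
  \<comment> \<open>The product transported to \<open>real ^ 4\<close>; the inverse of
    \<open>\<phi>\<close> is applied only within its range, by \<open>closed\<close>.\<close>
  define m where "m = (\<lambda>u u'. inv \<phi> (mul (\<phi> u) (\<phi> u')))"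
  have \<phi>m: "\<phi> (m u u') = mul (\<phi> u) (\<phi> u')" for u u'
    unfolding m_def by (rule f_inv_into_f[OF closed])
  have "DIM(real ^ 4) \<le> 2"
  proof (rule commutative_division_dim_le_2)
    show "bilinear m"
      unfolding bilinear_def
      by (intro conjI allI linearI injD[OF inj])
        (simp_all add: \<phi>m linear_add[OF lin] linear_scale[OF lin] bil_simps)
    show "m u u' = m u' u" for u u'
      unfolding m_def by (simp add: comm)
    show "u = 0 \<or> u' = 0" if "m u u' = 0" for u u'
    proof -
      have "mul (\<phi> u) (\<phi> u') = 0"
        using that \<phi>m[of u u'] by (simp add: linear_0[OF lin])
      then show ?thesis
        using nz inj lin by (metis linear_injective_0)
    qed
  qed
  then show False by simp
qed

section \<open>The converse and the equivalence\<close>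

text \<open>The relation always yields \<open>x^2 = k e + l x\<close>, so both powers lie in the
  span of \<open>e\<close> and \<open>x\<close>. Associators with \<open>e\<close> vanish, and what
  remains is a multiple of \<open>(x, x, x)\<close>, which is 0 because \<open>x\<close> commutes
  with \<open>k e + l x\<close>.\<close>

lemma associator_powers_eq_0_of_quadratic_relation:
  fixes mul :: "'a::real_vector \<Rightarrow> 'a \<Rightarrow> 'a"
  assumes bil: "bilinear mul" and e: "two_sided_unit mul e" "e \<noteq> 0"
    and rel: "(a, b, c) \<noteq> (0, 0, 0)" "a *\<^sub>R e + b *\<^sub>R x + c *\<^sub>R mul x x = 0"
    and q: "q \<in> {1, 2}" and r: "r \<in> {1, 2}"
  shows "associator mul x (alg_power mul x q) (alg_power mul x r) = 0"
proof -
  have ee: "mul e z = z" "mul z e = z" for z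
    using e by (auto simp: two_sided_unit_def)
  note bil_simps = bilinear_ladd[OF bil] bilinear_radd[OF bil] bilinear_lmul[OF bil] bilinear_rmul[OF bil]
  obtain k l where sq: "mul x x = k *\<^sub>R e + l *\<^sub>R x"
  proof (cases "c = 0")
    \<comment> \<open>Here \<open>b \<noteq> 0\<close>, as otherwise \<open>a e = 0\<close> with
      \<open>a \<noteq> 0\<close>. Thus \<open>x\<close> is a multiple of \<open>e\<close>, and
      \<open>x^2\<close> is the same multiple of \<open>x\<close>.\<close>
    case True
    then have "b \<noteq> 0" using rel e(2) by auto
    have "x = (- a / b) *\<^sub>R e"
    proof -
      have "b *\<^sub>R x = (- a) *\<^sub>R e"
        using rel(2) True by (simp add: eq_neg_iff_add_eq_0 add.commute)
      then have "inverse b *\<^sub>R (b *\<^sub>R x) = inverse b *\<^sub>R ((- a) *\<^sub>R e)" by simp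
      then show ?thesis using \<open>b \<noteq> 0\<close> by (simp add: field_simps)
    qed
    then have "mul x x = 0 *\<^sub>R e + (- a / b) *\<^sub>R x"
      by (metis add_0 bilinear_lmul[OF bil] ee(1) scaleR_zero_left)
    then show ?thesis using that by blast
  next
    case False
    have "c *\<^sub>R mul x x = - (a *\<^sub>R e + b *\<^sub>R x)"
      unfolding eq_neg_iff_add_eq_0 using rel(2) by (simp add: add.commute)
    then have "inverse c *\<^sub>R (c *\<^sub>R mul x x) = inverse c *\<^sub>R (- (a *\<^sub>R e + b *\<^sub>R x))" by simp
    then have "mul x x = (- a / c) *\<^sub>R e + (- b / c) *\<^sub>R x"
      using False by (simp add: field_simps)
    then show ?thesis using that by blast
  qed
  have xxx: "mul (mul x x) x = mul x (mul x x)"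
    by (simp add: sq bil_simps ee)
  have "\<exists>k l. alg_power mul x n = k *\<^sub>R e + l *\<^sub>R x" if "n \<in> {1, 2}" for n
  proof (cases "n = 1")
    case True
    then show ?thesis by (intro exI[of _ 0] exI[of _ 1]) simp
  next
    case False
    then show ?thesis using that sq by auto
  qed
  from this[OF q] this[OF r] obtain k1 l1 k2 l2 where
    "alg_power mul x q = k1 *\<^sub>R e + l1 *\<^sub>R x" "alg_power mul x r = k2 *\<^sub>R e + l2 *\<^sub>R x"
    by blast
  then show ?thesis
    by (simp add: associator_def bil_simps ee xxx algebra_simps)
qed

theorem theorem3:
  fixes mul :: "'a::real_vector \<Rightarrow> 'a \<Rightarrow> 'a"
    and q r :: nat
  assumes "real_division_algebra mul"
    and "alg_degree mul \<le> 4"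
    and "\<exists>e. left_unit mul e"
    and "q \<in> {1, 2}" and "r \<in> {1, 2}"
  shows "(\<forall>x. associator mul x (alg_power mul x q) (alg_power mul x r) = 0)
    \<longleftrightarrow> quadratic_algebra mul"
proof -
  note alg = real_division_algebra_facts[OF assms(1)]
  have e0: "e \<noteq> 0" if "left_unit mul e" for e
    using that alg(4) bilinear_lzero[OF alg(1)] unfolding left_unit_def by metis
  show ?thesis
  proof
    assume id: "\<forall>x. associator mul x (alg_power mul x q) (alg_power mul x r) = 0"
    obtain e where e: "left_unit mul e" using assms(3) ..
    have unit: "two_sided_unit mul e"
      by (rule two_sided_unit_of_left_unit[OF alg(1,3) e e0[OF e] assms(4,5)]) (use id in auto)
    have "associator mul y y y = 0" for y
      by (rule third_power_associative_of_unit[OF alg(1) unit assms(4,5)]) (use id in auto)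
    then show "quadratic_algebra mul"
      unfolding quadratic_algebra_def
      using quadratic_of_third_power_associative[OF alg(2,3) assms(2) unit] unit by blast
  next
    assume "quadratic_algebra mul"
    then obtain e where e: "two_sided_unit mul e"
      and rel: "\<And>x. \<exists>a b c. (a, b, c) \<noteq> (0, 0, 0) \<and> a *\<^sub>R e + b *\<^sub>R x + c *\<^sub>R mul x x = 0"
      unfolding quadratic_algebra_def by blast
    have "e \<noteq> 0"
      using e e0 by (simp add: two_sided_unit_def left_unit_def)
    show "\<forall>x. associator mul x (alg_power mul x q) (alg_power mul x r) = 0"
    proof
      fix x
      obtain a b c where "(a, b, c) \<noteq> (0, 0, 0)" "a *\<^sub>R e + b *\<^sub>R x + c *\<^sub>R mul x x = 0"
        using rel[of x] by blast
      then show "associator mul x (alg_power mul x q) (alg_power mul x r) = 0"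
        by (rule associator_powers_eq_0_of_quadratic_relation[OF alg(1) e \<open>e \<noteq> 0\<close> _ _ assms(4,5)])
    qed
  qed
qed

end
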